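(* Let $p,r$ be natural numbers with $0<r<p$ and $\gcd(r,2p)=1$. Then for every integer $n\ge 0$, $$E_{r}\big(2pn+r(p-r);2p\big)=\sum_{\substack{k,l\in\mathbb{Z}\\ k\ge|l|\\ n=p(k^2-l^2)/2+p(k+l)/2-lr}}(-1)^{k+l},$$ where the sum runs over all pairs of integers $(k,l)$ with $k\ge |l|$ satisfying $n=\frac{p(k^2-l^2)}{2}+\frac{p(k+l)}{2}-lr$.
   Context: For positive integers $N$ and $m$ and an integer $r$, define $E_{r}(N;m)=\#\{d\ge 1: d\mid N,\ d\equiv r \pmod m\}-\#\{d\ge 1: d\mid N,\ d\equiv -r\pmod m\}$, i.e. the number of positive divisors of $N$ congruent to $r$ modulo $m$ minus the number of positive divisors of $N$ congruent to $-r$ modulo $m$. *)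

theory Defs
  imports Complex_Main "HOL-Number_Theory.Cong"
begin

text \<open>Intended for positive \<open>N\<close> and \<open>m\<close>; for \<open>N = 0\<close> the two sets may be infinite.\<close>

definition E :: "int \<Rightarrow> nat \<Rightarrow> nat \<Rightarrow> int" where
  "E r N m =
     int (card {d::nat. d \<ge> 1 \<and> d dvd N \<and> [int d = r] (mod int m)})
   - int (card {d::nat. d \<ge> 1 \<and> d dvd N \<and> [int d = - r] (mod int m)})"

text \<open>
  The index set of the double sum. The equation is stated over the reals because the two halves
  \<open>p * (k^2 - l^2) / 2\<close> and \<open>p * (k + l) / 2\<close> need not be integers separately.
\<close>

definition index_pairs :: "nat \<Rightarrow> nat \<Rightarrow> nat \<Rightarrow> (int \<times> int) set" where
  "index_pairs p r n = {(k, l). k \<ge> \<bar>l\<bar> \<and>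
     real n = real p * ((real_of_int k)\<^sup>2 - (real_of_int l)\<^sup>2) / 2
            + real p * (real_of_int k + real_of_int l) / 2
            - real_of_int l * real r}"

end

theory Submission
  imports Defs
begin

text \<open>
  Put \<open>a = k + l\<close> and \<open>b = k - l\<close>, which are nonnegative integers of the same parity. Multiplying
  the equation that defines the index set by \<open>2p\<close> and completing the product turns it into
  \<open>(pa + r) (p(b + 1) - r) = N\<close> where \<open>N = 2pn + r(p - r)\<close>. If \<open>a\<close> and \<open>b\<close> are even, the first
  factor is a divisor of \<open>N\<close> congruent to \<open>r\<close> modulo \<open>2p\<close>; if they are odd, the second factor is
  one congruent to \<open>-r\<close>. Conversely, as \<open>r\<close> is invertible modulo \<open>2p\<close>, the residue of a divisor
  determines that of its cofactor, so every divisor in these two classes arises exactly once.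
\<close>

text \<open>Scaling by \<open>2 * p\<close>, nonzero because \<open>r < p\<close>, clears the
  halves; adding \<open>r * (p - r)\<close> then makes the right side factor. Both sides are now
  integers, so the real equation descends to \<open>int\<close>.\<close>

lemma mem_index_pairs_iff:
  fixes p r n :: nat
  assumes "r < p"
  shows "(k, l) \<in> index_pairs p r n \<longleftrightarrow> \<bar>l\<bar> \<le> k \<and>
     (int p * (k + l) + int r) * (int p * (k - l + 1) - int r) = int (2 * p * n + r * (p - r))"
proof -
  let ?P = "real p" and ?R = "real r" and ?K = "real_of_int k" and ?L = "real_of_int l"
  let ?X = "?P * (?K\<^sup>2 - ?L\<^sup>2) / 2 + ?P * (?K + ?L) / 2 - ?L * ?R"
  have "real n = ?X \<longleftrightarrow> 2 * ?P * real n = 2 * ?P * ?X"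
    using assms by simp
  also have "2 * ?P * ?X = (?P * (?K + ?L) + ?R) * (?P * (?K - ?L + 1) - ?R) - ?R * (?P - ?R)"
    by (simp add: field_simps power2_eq_square)
  also have "2 * ?P * real n = \<dots> \<longleftrightarrow>
      real_of_int ((int p * (k + l) + int r) * (int p * (k - l + 1) - int r))
        = real_of_int (2 * int p * int n + int r * (int p - int r))"
    by simp linarith
  also have "\<dots> \<longleftrightarrow> (int p * (k + l) + int r) * (int p * (k - l + 1) - int r)
        = 2 * int p * int n + int r * (int p - int r)"
    by (rule of_int_eq_iff)
  finally show ?thesis
    using assms by (simp add: index_pairs_def of_nat_diff)
qed

text \<open>As \<open>s\<close> is a unit modulo \<open>m\<close>, it cancels from
  \<open>s * e\<close> and \<open>s * t\<close>. This turns the residue of a divisor of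
  \<open>N\<close> into that of its cofactor.\<close>

lemma cong_cofactor:
  fixes d e s t m :: int
  assumes "coprime s m" and "[d = s] (mod m)" and "[d * e = s * t] (mod m)"
  shows "[e = t] (mod m)"
proof -
  have "[s * e = s * t] (mod m)"
    using assms(2,3) by (meson cong_mult cong_refl cong_sym cong_trans)
  then show ?thesis
    using assms(1) by (simp add: cong_mult_lcancel)
qed

text \<open>A negative \<open>j\<close> would force \<open>x \<le> s - m < 0\<close>. Nonnegativity
  of these multipliers is what later yields \<open>\<bar>l\<bar> \<le> k\<close>.\<close>

lemma cong_pos_obtain:
  fixes x s m :: int
  assumes "[x = s] (mod m)" and "0 < x" and "s < m" and "0 < m"
  obtains j where "0 \<le> j" and "x = s + m * j"
proof -
  obtain j where j: "x = s + m * j"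
    using assms(1) by (metis cong_iff_lin cong_sym)
  have "0 \<le> j"
  proof (rule ccontr)
    assume "\<not> 0 \<le> j"
    then have "m * j \<le> m * (-1)"
      using assms(4) by (intro mult_left_mono) auto
    then show False
      using j assms(2,3) by linarith
  qed
  then show thesis
    using j that by blast
qed

lemma mult_cofactor_int:
  fixes d N :: nat
  assumes "d dvd N" and "0 < N"
  obtains e :: int where "int N = int d * e" and "0 < e"
proof -
  obtain e where "N = d * e"
    using assms(1) by blast
  then show thesis
    using assms(2) that[of "int e"] by simp
qed

context
  fixes p r n N :: nat
  assumes r_pos: "0 < r" and r_less: "r < p" and coprime: "gcd r (2 * p) = 1"
    and N_def: "N = 2 * p * n + r * (p - r)"
begin

lemma N_pos: "0 < N"
  using r_pos r_less by (simp add: N_def)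

lemma int_N: "int N = 2 * int p * int n + int r * (int p - int r)"
  using r_less by (simp add: N_def of_nat_diff)

lemma coprime_int: "coprime (int r) (2 * int p)"
proof -
  have "coprime (int r) (int (2 * p))"
    using coprime unfolding coprime_int_iff by (simp add: coprime_iff_gcd_eq_1)
  then show ?thesis by simp
qed

lemma mem_iff:
  "(k, l) \<in> index_pairs p r n \<longleftrightarrow> \<bar>l\<bar> \<le> k \<and>
     (int p * (k + l) + int r) * (int p * (k - l + 1) - int r) = int N"
  unfolding N_def by (rule mem_index_pairs_iff[OF r_less])

text \<open>The first factor is positive since \<open>k + l \<ge> 0\<close>, and the second then
  takes the sign of \<open>N\<close>. Hence \<open>nat\<close> loses nothing in the two bijections
  below.\<close>

lemma factors_pos:
  assumes "(k, l) \<in> index_pairs p r n"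
  shows "0 < int p * (k + l) + int r" and "0 < int p * (k - l + 1) - int r"
proof -
  show *: "0 < int p * (k + l) + int r"
    using assms r_pos by (intro add_nonneg_pos) (auto simp: mem_iff)
  have "0 < (int p * (k + l) + int r) * (int p * (k - l + 1) - int r)"
    using assms N_pos by (simp add: mem_iff)
  then show "0 < int p * (k - l + 1) - int r"
    using * by (simp add: zero_less_mult_iff)
qed

text \<open>Nonzero factors with the fixed product \<open>N\<close> determine each other, and
  together they determine \<open>k + l\<close> and \<open>k - l\<close>. The disjunction serves
  injectivity in both parities.\<close>

lemma index_pairs_eqI:
  assumes "(k, l) \<in> index_pairs p r n" and "(k', l') \<in> index_pairs p r n"
    and "int p * (k + l) + int r = int p * (k' + l') + int r \<or>
         int p * (k - l + 1) - int r = int p * (k' - l' + 1) - int r"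
  shows "(k, l) = (k', l')"
proof -
  have "(int p * (k + l) + int r) * (int p * (k - l + 1) - int r)
      = (int p * (k' + l') + int r) * (int p * (k' - l' + 1) - int r)"
    using assms(1,2) by (simp add: mem_iff)
  then have "int p * (k + l) + int r = int p * (k' + l') + int r"
    and "int p * (k - l + 1) - int r = int p * (k' - l' + 1) - int r"
    using assms(3) factors_pos[OF assms(1)] factors_pos[OF assms(2)]
    by (metis mult_cancel_left mult_cancel_right less_irrefl)+
  then have "k + l = k' + l'" and "k - l = k' - l'"
    using r_less by auto
  then show ?thesis by simp
qed

lemma bij_betw_even:
  "bij_betw (\<lambda>(k, l). nat (int p * (k + l) + int r))
     {(k, l) \<in> index_pairs p r n. even (k + l)}
     {d. d \<ge> 1 \<and> d dvd N \<and> [int d = int r] (mod int (2 * p))}"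
  (is "bij_betw ?f ?A ?D")
  unfolding bij_betw_def
proof (intro conjI equalityI subsetI)
  show "inj_on ?f ?A"
  proof (rule inj_onI)
    fix x y assume xy: "x \<in> ?A" "y \<in> ?A" "?f x = ?f y"
    obtain k l k' l' where eqs: "x = (k, l)" "y = (k', l')"
      by (cases x, cases y)
    show "x = y"
      using xy factors_pos(1)[of k l] factors_pos(1)[of k' l']
      unfolding eqs by (intro index_pairs_eqI) (auto simp: eq_nat_nat_iff)
  qed
next
  fix d assume "d \<in> ?f ` ?A"
  then obtain k l where kl: "(k, l) \<in> index_pairs p r n" "even (k + l)"
    and d: "int d = int p * (k + l) + int r"
    using factors_pos(1) by force
  have "int d dvd int N"
    using kl(1) d mem_iff by (metis dvd_triv_left)
  moreover have "[int d = int r] (mod int (2 * p))"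
    using kl(2) by (auto simp: d cong_iff_dvd_diff elim!: evenE)
  moreover have "d \<ge> 1"
    using factors_pos(1)[OF kl(1)] d by linarith
  ultimately show "d \<in> ?D" by simp
next
  fix d assume d: "d \<in> ?D"
  obtain e where e: "int N = int d * e" "0 < e"
    using d N_pos by (blast elim: mult_cofactor_int)
  have d_cong: "[int d = int r] (mod 2 * int p)"
    using d by simp
  \<comment> \<open>\<open>N\<close> differs from \<open>r * (p - r)\<close> by the multiple
    \<open>2 * p * n\<close> of the modulus.\<close>
  have "[int d * e = int r * (int p - int r)] (mod 2 * int p)"
    unfolding e(1)[symmetric] int_N by (simp add: cong_iff_dvd_diff)
  then have e_cong: "[e = int p - int r] (mod 2 * int p)"
    by (rule cong_cofactor[OF coprime_int d_cong])
  obtain j where j: "0 \<le> j" "int d = int r + 2 * int p * j"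
    using d_cong d r_less by (elim cong_pos_obtain) auto
  obtain i where i: "0 \<le> i" "e = int p - int r + 2 * int p * i"
    using e_cong e(2) r_pos r_less by (elim cong_pos_obtain) auto
  \<comment> \<open>Comparing \<open>d\<close> and \<open>e\<close> with the two factors gives
    \<open>k + l = 2 * j\<close> and \<open>k - l = 2 * i\<close>.\<close>
  have factors: "int p * ((j + i) + (j - i)) + int r = int d"
    "int p * ((j + i) - (j - i) + 1) - int r = e"
    using i(2) j(2) by (simp_all add: algebra_simps)
  then have "(j + i, j - i) \<in> index_pairs p r n"
    using i(1) j(1) unfolding mem_iff factors e(1) by auto
  moreover have "d = ?f (j + i, j - i)"
    by (simp only: split factors nat_int)
  ultimately show "d \<in> ?f ` ?A"
    by (intro image_eqI[of _ _ "(j + i, j - i)"]) auto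
qed

text \<open>Here \<open>k - l + 1\<close> is even, so it is the second factor that has a residue
  independent of the parity of \<open>p\<close>, and the roles of divisor and cofactor swap.\<close>

lemma bij_betw_odd:
  "bij_betw (\<lambda>(k, l). nat (int p * (k - l + 1) - int r))
     {(k, l) \<in> index_pairs p r n. odd (k + l)}
     {d. d \<ge> 1 \<and> d dvd N \<and> [int d = - int r] (mod int (2 * p))}"
  (is "bij_betw ?f ?A ?D")
  unfolding bij_betw_def
proof (intro conjI equalityI subsetI)
  show "inj_on ?f ?A"
  proof (rule inj_onI)
    fix x y assume xy: "x \<in> ?A" "y \<in> ?A" "?f x = ?f y"
    obtain k l k' l' where eqs: "x = (k, l)" "y = (k', l')"
      by (cases x, cases y)
    show "x = y"
      using xy factors_pos(2)[of k l] factors_pos(2)[of k' l']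
      unfolding eqs by (intro index_pairs_eqI) (auto simp: eq_nat_nat_iff)
  qed
next
  fix d assume "d \<in> ?f ` ?A"
  then obtain k l where kl: "(k, l) \<in> index_pairs p r n" "odd (k + l)"
    and d: "int d = int p * (k - l + 1) - int r"
    using factors_pos(2) by force
  have "int d dvd int N"
    using kl(1) d mem_iff by (metis dvd_triv_right)
  moreover have "even (k - l + 1)"
    using kl(2) by simp
  then have "[int d = - int r] (mod int (2 * p))"
    by (auto simp: d cong_iff_dvd_diff elim!: evenE)
  moreover have "d \<ge> 1"
    using factors_pos(2)[OF kl(1)] d by linarith
  ultimately show "d \<in> ?D" by simp
next
  fix d assume d: "d \<in> ?D"
  obtain e where e: "int N = int d * e" "0 < e"
    using d N_pos by (blast elim: mult_cofactor_int)
  have d_cong: "[int d = - int r] (mod 2 * int p)"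
    using d by simp
  \<comment> \<open>The two signs put the product in the form needed to cancel the unit
    \<open>- r\<close>.\<close>
  have "[int d * e = - int r * - (int p - int r)] (mod 2 * int p)"
    unfolding e(1)[symmetric] int_N by (simp add: cong_iff_dvd_diff algebra_simps)
  then have "[e = - (int p - int r)] (mod 2 * int p)"
    by (rule cong_cofactor[OF _ d_cong, rotated]) (use coprime_int in simp)
  then have e_cong: "[e = int r + int p] (mod 2 * int p)"
    by (rule cong_trans) (simp add: cong_iff_dvd_diff)
  \<comment> \<open>The least positive representative is used, so that \<open>j\<close> starts at 0
    and \<open>k - l = 2 * j + 1\<close> is nonnegative.\<close>
  have d_cong': "[int d = 2 * int p - int r] (mod 2 * int p)"
    using d_cong by (rule cong_trans) (simp add: cong_iff_dvd_diff)
  obtain j where j: "0 \<le> j" "int d = 2 * int p - int r + 2 * int p * j"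
    using d_cong' d r_pos r_less by (elim cong_pos_obtain) auto
  obtain i where i: "0 \<le> i" "e = int r + int p + 2 * int p * i"
    using e_cong e(2) r_less by (elim cong_pos_obtain) auto
  \<comment> \<open>The pair solves \<open>k + l = 2 * i + 1\<close> and
    \<open>k - l = 2 * j + 1\<close>.\<close>
  have factors: "int p * ((i + j + 1) + (i - j)) + int r = e"
    "int p * ((i + j + 1) - (i - j) + 1) - int r = int d"
    using i(2) j(2) by (simp_all add: algebra_simps)
  then have "(i + j + 1, i - j) \<in> index_pairs p r n"
    using i(1) j(1) unfolding mem_iff factors e(1) by auto
  moreover have "d = ?f (i + j + 1, i - j)"
    by (simp only: split factors nat_int)
  ultimately show "d \<in> ?f ` ?A"
    by (intro image_eqI[of _ _ "(i + j + 1, i - j)"]) auto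
qed

text \<open>Finiteness is carried back from the divisors of \<open>N\<close>; it rules out that the
  sum is merely the default value 0 of a sum over an infinite set.\<close>

lemma finite_index_pairs_and_E_eq:
  "finite (index_pairs p r n) \<and>
   E (int r) N (2 * p) = (\<Sum>(k, l)\<in>index_pairs p r n. (-1) ^ nat (k + l))"
proof -
  let ?I = "index_pairs p r n"
  let ?A = "{(k, l) \<in> ?I. even (k + l)}" and ?B = "{(k, l) \<in> ?I. odd (k + l)}"
  have "finite {d. d \<ge> 1 \<and> d dvd N \<and> [int d = s] (mod int (2 * p))}" for s
    using finite_divisors_nat[OF N_pos] by (rule rev_finite_subset) auto
  then have fin: "finite ?A" "finite ?B"
    using bij_betw_finite[OF bij_betw_even] bij_betw_finite[OF bij_betw_odd] by blast+
  have split: "?I = ?A \<union> ?B" and disj: "?A \<inter> ?B = {}"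
    by auto
  \<comment> \<open>The exponent is thus not truncated by \<open>nat\<close> and keeps its
    parity.\<close>
  have nonneg: "0 \<le> k + l" if "(k, l) \<in> ?I" for k l
    using that by (auto simp: mem_iff)
  have "(\<Sum>(k, l)\<in>?I. (-1) ^ nat (k + l)) =
      (\<Sum>(k, l)\<in>?A. (-1) ^ nat (k + l)) + (\<Sum>(k, l)\<in>?B. (-1) ^ nat (k + l) :: int)"
    by (subst split) (rule sum.union_disjoint[OF fin disj])
  also have "(\<Sum>(k, l)\<in>?A. (-1) ^ nat (k + l)) = (\<Sum>x\<in>?A. 1 :: int)"
    using nonneg by (intro sum.cong) (auto simp: even_nat_iff)
  also have "(\<Sum>(k, l)\<in>?B. (-1) ^ nat (k + l)) = (\<Sum>x\<in>?B. - 1 :: int)"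
    using nonneg by (intro sum.cong) (auto simp: even_nat_iff)
  also have "(\<Sum>x\<in>?A. 1) + (\<Sum>x\<in>?B. - 1) = E (int r) N (2 * p)"
    unfolding E_def
    by (simp add: bij_betw_same_card[OF bij_betw_even, simplified]
      bij_betw_same_card[OF bij_betw_odd, simplified])
  finally have "E (int r) N (2 * p) = (\<Sum>(k, l)\<in>?I. (-1) ^ nat (k + l))" ..
  moreover have "finite ?I"
    using fin by (subst split) simp
  ultimately show ?thesis by blast
qed

end

theorem theorem1p1:
  fixes p r n :: nat
  assumes "0 < r" and "r < p" and "gcd r (2 * p) = 1"
  shows "finite (index_pairs p r n) \<and>
         E (int r) (2 * p * n + r * (p - r)) (2 * p)
           = (\<Sum>(k, l)\<in>index_pairs p r n. (-1) ^ nat (k + l))"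
  using assms refl by (rule finite_index_pairs_and_E_eq)

end
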